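(* Let $\varphi_6:\mathbb{N}\to\mathbb{N}$ be the function defined as follows. The values $\varphi_6(0),\varphi_6(1),\dots,\varphi_6(29)$ are, in order, $$8,9,5,6,7,2,3,4,0,1,\ 16,17,18,19,20,21,10,11,12,13,\ 14,15,24,25,22,23,28,29,26,27,$$ and for $x\ge 30$, $\varphi_6(x)=x\oplus_2 4$. Then, for all nonnegative integers $a,b$, the Halve Nim position $a^1b^16^1$ is a $\mathcal{P}$-position if and only if $b=\varphi_6(a)$. Furthermore, for $a,b\ge 30$, $a^1b^16^1$ is a $\mathcal{P}$-position if and only if $(a+2)\oplus(b+2)=4$.
   Context: $\mathbb{N}$ is the set of nonnegative integers and $\oplus$ denotes bitwise XOR. The $n$-shifted bitwise sum is $x\oplus_n y=\bigl((x+n)\oplus y\bigr)-n$. Halve Nim is a two-player game played on finitely many piles of coins; players alternate moves and a player who cannot move loses. A move is one of: (i) choose one pile and remove at least one coin from it; (ii) halve the game: simultaneously replace every pile of $m$ coins by a pile of $\lfloor m/2\rfloor$ coins. When there are no coins left, no move is available (halving requires at least one coin to be present). A position is a $\mathcal{P}$-position if the player who is not about to move has a winning strategy (equivalently, every move from it leads to an $\mathcal{N}$-position), and an $\mathcal{N}$-position if the player about to move has a winning strategy. $a^1b^1c^1$ denotes the position with three piles of sizes $a$, $b$, $c$ (a pile of size $0$ is an empty pile); in particular $a^1b^16^1$ has piles of sizes $a$, $b$, $6$. *)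

theory Defs
  imports "HOL-Library.Multiset"
begin

unbundle bit_operations_syntax

text \<open>
  The \<open>n\<close>-shifted bitwise sum. The outer subtraction truncates at 0; for \<open>n = 2\<close>, \<open>y = 4\<close>,
  the only instance used below, truncation takes effect only for \<open>x \<in> {2, 3}\<close>.
\<close>

definition shifted_xor :: "nat \<Rightarrow> nat \<Rightarrow> nat \<Rightarrow> nat" where
  "shifted_xor n x y = ((x + n) XOR y) - n"

text \<open>
  A position is the multiset of its pile sizes; empty piles may be present and do not
  matter. The side condition of \<open>halve\<close> says that at least one coin is left.
\<close>

inductive halve_nim_move :: "nat multiset \<Rightarrow> nat multiset \<Rightarrow> bool" where
  remove: "k < m \<Longrightarrow> halve_nim_move (add_mset m M) (add_mset k M)"
| halve: "\<exists>m\<in>#M. m > 0 \<Longrightarrow> halve_nim_move M (image_mset (\<lambda>m. m div 2) M)"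

text \<open>
  Existence of a winning strategy under normal play, for the player about to move
  (\<open>N_position\<close>) and for the other player (\<open>P_position\<close>). A position without moves is a
  \<open>P_position\<close>.
\<close>

inductive P_position :: "nat multiset \<Rightarrow> bool" and N_position :: "nat multiset \<Rightarrow> bool" where
  P: "(\<And>M'. halve_nim_move M M' \<Longrightarrow> N_position M') \<Longrightarrow> P_position M"
| N: "halve_nim_move M M' \<Longrightarrow> P_position M' \<Longrightarrow> N_position M"

lemma halve_nim_move_decreases:
  assumes "halve_nim_move M M'"
  shows "sum_mset M' < sum_mset M"
  using assms
proof cases
  case (halve)
  from halve(2) obtain m where m: "m \<in># M" "m > 0" by blast
  then obtain A where A: "M = add_mset m A" by (metis insert_DiffM)
  have "(\<Sum>k\<in>#A. k div 2) \<le> (\<Sum>k\<in>#A. k)"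
    by (rule sum_mset_mono) simp
  moreover have "m div 2 < m" using m by simp
  ultimately show ?thesis using halve A by simp
qed simp

lemma N_position_iff_not_P_position: "N_position M \<longleftrightarrow> \<not> P_position M"
proof (induction "sum_mset M" arbitrary: M rule: less_induct)
  case less
  then have IH: "N_position M' \<longleftrightarrow> \<not> P_position M'" if "halve_nim_move M M'" for M'
    using halve_nim_move_decreases[OF that] by blast
  show ?case
    by (meson IH P_position.cases N_position.cases P_position_N_position.P P_position_N_position.N)
qed

lemma P_position_iff: "P_position M \<longleftrightarrow> (\<forall>M'. halve_nim_move M M' \<longrightarrow> N_position M')"
  by (meson P_position.cases P_position_N_position.P)

definition phi6 :: "nat \<Rightarrow> nat" where
  "phi6 x =
    (if x < 30
     then [8, 9, 5, 6, 7, 2, 3, 4, 0, 1,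
           16, 17, 18, 19, 20, 21, 10, 11, 12, 13,
           14, 15, 24, 25, 22, 23, 28, 29, 26, 27] ! x
     else shifted_xor 2 x 4)"

end

theory Submission
  imports Defs
begin

text \<open>
  For each \<open>c \<le> 6\<close> the P-positions with piles \<open>x\<close>, \<open>b\<close>, \<open>c\<close> are the graph of an
  involution that moves every \<open>x\<close> by at most 8. The value at \<open>x\<close> is entry \<open>c\<close> of an explicit list
  \<open>row x\<close>, a table for \<open>x < 30\<close> and a regular pattern afterwards. That these involutions do
  describe the P-positions is a condition relating \<open>row x\<close>, \<open>row (x div 2)\<close> and the
  \<open>row y\<close> with \<open>\<bar>y - x\<bar> \<le> 8\<close>: if \<open>b\<close> is neither too large nor \<open>x\<close> too large, so that
  shrinking \<open>b\<close> or \<open>x\<close> does not win, then \<open>b\<close> is close to \<open>x\<close>, and a move in the third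
  pile or halving must win. The regular pattern is invariant under shifts by 8, hence everything
  reduces to a finite computation.
\<close>

section \<open>Moves and P-positions with three piles\<close>

lemma halve_nim_move_three_piles_iff:
  "halve_nim_move {#a, b, c#} M \<longleftrightarrow>
     (\<exists>k<a. M = {#k, b, c#}) \<or> (\<exists>k<b. M = {#a, k, c#}) \<or> (\<exists>k<c. M = {#a, b, k#}) \<or>
     (a, b, c) \<noteq> (0, 0, 0) \<and> M = {#a div 2, b div 2, c div 2#}" (is "?L \<longleftrightarrow> ?R")
proof
  assume ?L
  then show ?R
  proof cases
    case (remove k m N)
    then have "m \<in># {#a, b, c#}" by simp
    then consider "m = a" | "m = b" | "m = c" by auto
    then show ?thesis
    proof cases
      case 1
      then have "N = {#b, c#}" using remove by simp
      then show ?thesis using 1 remove by auto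
    next
      case 2
      then have "add_mset b N = add_mset b {#a, c#}" using remove by (simp add: add_mset_commute)
      then have "N = {#a, c#}" by simp
      then show ?thesis using 2 remove by (auto simp: add_mset_commute)
    next
      case 3
      then have "add_mset c N = add_mset c {#a, b#}" using remove by (simp add: add_mset_commute)
      then have "N = {#a, b#}" by simp
      then show ?thesis using 3 remove by (auto simp: add_mset_commute)
    qed
  next
    case halve
    then show ?thesis by auto
  qed
next
  have 1: "halve_nim_move {#a, b, c#} {#k, b, c#}" if "k < a" for k
    using halve_nim_move.remove[OF that, of "{#b, c#}"] by simp
  have 2: "halve_nim_move {#a, b, c#} {#a, k, c#}" if "k < b" for k
    using halve_nim_move.remove[OF that, of "{#a, c#}"] by (simp add: add_mset_commute)
  have 3: "halve_nim_move {#a, b, c#} {#a, b, k#}" if "k < c" for k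
    using halve_nim_move.remove[OF that, of "{#a, b#}"] by (simp add: add_mset_commute)
  have 4: "halve_nim_move {#a, b, c#} {#a div 2, b div 2, c div 2#}" if "(a, b, c) \<noteq> (0, 0, 0)"
    using halve_nim_move.halve[of "{#a, b, c#}"] that by auto
  assume ?R
  then show ?L using 1 2 3 4 by blast
qed

lemma P_position_three_piles_iff:
  "P_position {#a, b, c#} \<longleftrightarrow>
     (\<forall>k<a. \<not> P_position {#k, b, c#}) \<and> (\<forall>k<b. \<not> P_position {#a, k, c#}) \<and>
     (\<forall>k<c. \<not> P_position {#a, b, k#}) \<and>
     ((a, b, c) \<noteq> (0, 0, 0) \<longrightarrow> \<not> P_position {#a div 2, b div 2, c div 2#})"
  unfolding P_position_iff[of "{#a, b, c#}"] N_position_iff_not_P_position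
    halve_nim_move_three_piles_iff by blast

text \<open>By induction on the number of coins, the P-positions form the only set without internal
  moves into which every other position has a move. Internal moves in the first two piles are
  excluded by \<open>sym\<close> and \<open>unique\<close>, in the third by \<open>disjoint\<close>.
  Restricting to \<open>c \<le> n\<close> is harmless, as no move enlarges \<open>c\<close>.\<close>

lemma P_position_three_piles_characterization:
  fixes R :: "nat \<Rightarrow> nat \<Rightarrow> nat \<Rightarrow> bool"
  assumes sym: "\<And>c a b. c \<le> n \<Longrightarrow> R c a b \<Longrightarrow> R c b a"
    and unique: "\<And>c a b b'. c \<le> n \<Longrightarrow> R c a b \<Longrightarrow> R c a b' \<Longrightarrow> b = b'"
    and disjoint: "\<And>c c' a b. c \<le> n \<Longrightarrow> c' \<le> n \<Longrightarrow> R c a b \<Longrightarrow> R c' a b \<Longrightarrow> c = c'"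
    and halving: "\<And>c a b. c \<le> n \<Longrightarrow> R c a b \<Longrightarrow> (a, b, c) \<noteq> (0, 0, 0) \<Longrightarrow>
                    \<not> R (c div 2) (a div 2) (b div 2)"
    and zero: "R 0 0 0"
    and complete: "\<And>c a b. c \<le> n \<Longrightarrow> \<not> R c a b \<Longrightarrow>
                    (\<exists>b'<b. R c a b') \<or> (\<exists>a'<a. R c a' b) \<or> (\<exists>c'<c. R c' a b) \<or>
                    R (c div 2) (a div 2) (b div 2)"
    and "c \<le> n"
  shows "P_position {#a, b, c#} \<longleftrightarrow> R c a b"
  using \<open>c \<le> n\<close>
proof (induction "a + b + c" arbitrary: a b c rule: less_induct)
  case less
  have a: "P_position {#k, b, c#} \<longleftrightarrow> R c k b" if "k < a" for k
    using less.hyps[of k b c] that less.prems by simp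
  have b: "P_position {#a, k, c#} \<longleftrightarrow> R c a k" if "k < b" for k
    using less.hyps[of a k c] that less.prems by simp
  have c: "P_position {#a, b, k#} \<longleftrightarrow> R k a b" if "k < c" for k
    using less.hyps[of a b k] that less.prems by simp
  have h: "P_position {#a div 2, b div 2, c div 2#} \<longleftrightarrow> R (c div 2) (a div 2) (b div 2)"
    if "(a, b, c) \<noteq> (0, 0, 0)"
  proof (rule less.hyps)
    have "a > 0 \<or> b > 0 \<or> c > 0" using that by simp
    then show "a div 2 + b div 2 + c div 2 < a + b + c" by linarith
    show "c div 2 \<le> n" using less.prems by linarith
  qed
  have "P_position {#a, b, c#} \<longleftrightarrow>
     (\<forall>k<a. \<not> R c k b) \<and> (\<forall>k<b. \<not> R c a k) \<and> (\<forall>k<c. \<not> R k a b) \<and>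
     ((a, b, c) \<noteq> (0, 0, 0) \<longrightarrow> \<not> R (c div 2) (a div 2) (b div 2))"
    unfolding P_position_three_piles_iff[of a b c] using a b c h by blast
  also have "\<dots> \<longleftrightarrow> R c a b"
  proof
    assume R: "R c a b"
    have "\<not> R c k b" if "k < a" for k
      using that R sym unique less.prems by (metis less_irrefl)
    moreover have "\<not> R c a k" if "k < b" for k
      using that R unique less.prems by (metis less_irrefl)
    moreover have "\<not> R k a b" if "k < c" for k
      using that R disjoint[of c k a b] less.prems by auto
    ultimately show "(\<forall>k<a. \<not> R c k b) \<and> (\<forall>k<b. \<not> R c a k) \<and> (\<forall>k<c. \<not> R k a b) \<and>
     ((a, b, c) \<noteq> (0, 0, 0) \<longrightarrow> \<not> R (c div 2) (a div 2) (b div 2))"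
      using halving[OF less.prems R] by blast
  next
    assume *: "(\<forall>k<a. \<not> R c k b) \<and> (\<forall>k<b. \<not> R c a k) \<and> (\<forall>k<c. \<not> R k a b) \<and>
     ((a, b, c) \<noteq> (0, 0, 0) \<longrightarrow> \<not> R (c div 2) (a div 2) (b div 2))"
    show "R c a b"
    proof (rule ccontr)
      assume "\<not> R c a b"
      moreover have "(a, b, c) \<noteq> (0, 0, 0)" using zero \<open>\<not> R c a b\<close> by fastforce
      ultimately show False using complete[OF less.prems, of a b] * by blast
    qed
  qed
  finally show ?case .
qed

section \<open>The involutions and the condition on them\<close>

text \<open>
  For \<open>k\<close> a power of two, \<open>flip k d x = ((x + d) XOR k) - d\<close>.
\<close>

definition flip :: "int \<Rightarrow> int \<Rightarrow> int \<Rightarrow> int" where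
  "flip k d x = (if (x + d) mod (2 * k) < k then x + k else x - k)"

text \<open>
  For \<open>x \<ge> 30\<close> and \<open>c = 0\<close> the involution fixes \<open>x\<close> if \<open>phase x\<close> and sends it to
  \<open>x XOR 2\<close> otherwise. The phase switches at 28, 56, 112, \<open>\<dots>\<close>, since halving must not lead
  from one P-position to another.
\<close>

function phase :: "int \<Rightarrow> bool" where
  "phase x = (if x < 28 then True else \<not> phase (x div 2))"
  by auto
termination by (relation "measure nat") auto

declare phase.simps [simp del]

text \<open>Entries 0 to 3 are \<open>y\<close>, \<open>y XOR 1\<close>, \<open>y XOR 2\<close>,
  \<open>y XOR 3\<close>, a permutation of the aligned block of four containing \<open>x\<close>;
  \<open>t\<close> only decides whether entries 0, 1 are exchanged with 2, 3. Entries 4 to 6 do not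
  depend on \<open>t\<close>.\<close>

definition regular_row :: "bool \<Rightarrow> int \<Rightarrow> int list" where
  "regular_row t x =
     (let y = (if t then x else flip 2 0 x); z = flip 2 0 y; w = flip 2 2 x
      in [y, flip 1 0 y, z, flip 1 0 z, w, flip 1 0 w, flip 4 2 x])"

definition row :: "int \<Rightarrow> int list" where
  "row x =
     (if x < 30 then
      [[0, 2, 1, 3, 4, 5, 8], [2, 3, 0, 1, 5, 4, 9], [1, 0, 2, 4, 3, 6, 5],
      [3, 1, 4, 0, 2, 7, 6], [4, 5, 3, 2, 0, 1, 7], [5, 4, 6, 7, 1, 0, 2],
      [8, 9, 5, 6, 7, 2, 3], [9, 8, 7, 5, 6, 3, 4], [6, 7, 8, 9, 10, 11, 0],
      [7, 6, 9, 8, 11, 10, 1], [12, 13, 10, 11, 8, 9, 16], [13, 12, 11, 10, 9, 8, 17],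
      [10, 11, 12, 13, 14, 15, 18], [11, 10, 13, 12, 15, 14, 19], [14, 15, 18, 19, 12, 13, 20],
      [15, 14, 19, 18, 13, 12, 21], [16, 17, 20, 21, 18, 19, 10], [17, 16, 21, 20, 19, 18, 11],
      [18, 19, 14, 15, 16, 17, 12], [19, 18, 15, 14, 17, 16, 13], [20, 21, 16, 17, 22, 23, 14],
      [21, 20, 17, 16, 23, 22, 15], [22, 23, 26, 27, 20, 21, 24], [23, 22, 27, 26, 21, 20, 25],
      [24, 25, 28, 29, 26, 27, 22], [25, 24, 29, 28, 27, 26, 23], [26, 27, 22, 23, 24, 25, 28],
      [27, 26, 23, 22, 25, 24, 29], [30, 31, 24, 25, 28, 29, 26], [31, 30, 25, 24, 29, 28, 27]] ! nat x
      else regular_row (phase x) x)"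

text \<open>
  All integer ranges are explicit lists, so that the condition can be computed for given \<open>x\<close>.
\<close>

definition row_ok :: "(int \<Rightarrow> int list) \<Rightarrow> int list \<Rightarrow> int \<Rightarrow> bool" where
  "row_ok V h x \<longleftrightarrow> distinct (V x) \<and> (\<forall>c\<in>set [0..<7].
     0 \<le> V x ! c \<and> \<bar>V x ! c - x\<bar> \<le> 8 \<and>
     (x = 0 \<and> c = 0 \<or> V x ! c div 2 \<noteq> h ! (c div 2)) \<and>
     (\<forall>y\<in>set [x - 8..x + 8]. 0 \<le> y \<longrightarrow>
        (V x ! c = y \<longrightarrow> V y ! c = x) \<and>
        (y < V x ! c \<and> x < V y ! c \<longrightarrow> y \<in> set (take c (V x)) \<or> y div 2 = h ! (c div 2))))"

text \<open>Trades the computable lists for plain bounds. The parameter \<open>h\<close> stands for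
  the row at \<open>x div 2\<close>, which in the regular pattern has the opposite phase.\<close>

lemma row_ok_iff:
  "row_ok V h x \<longleftrightarrow> distinct (V x) \<and> (\<forall>c<7.
     0 \<le> V x ! c \<and> \<bar>V x ! c - x\<bar> \<le> 8 \<and>
     (x = 0 \<and> c = 0 \<or> V x ! c div 2 \<noteq> h ! (c div 2)) \<and>
     (\<forall>y. x - 8 \<le> y \<longrightarrow> y \<le> x + 8 \<longrightarrow> 0 \<le> y \<longrightarrow>
        (V x ! c = y \<longrightarrow> V y ! c = x) \<and>
        (y < V x ! c \<and> x < V y ! c \<longrightarrow> y \<in> set (take c (V x)) \<or> y div 2 = h ! (c div 2))))"
  unfolding row_ok_def set_upto set_upt atLeastLessThan_iff atLeastAtMost_iff Ball_def by blast

section \<open>Finite verification\<close>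

text \<open>One period of length 16 is checked: a shift of \<open>r\<close> by 16 shifts
  \<open>r div 2\<close> by 8. Starting at 16 keeps all neighbours at distance up to 8
  nonnegative.\<close>

lemma regular_row_ok:
  assumes "16 \<le> r" "r \<le> 31"
  shows "row_ok (regular_row t) (regular_row (\<not> t) (r div 2)) r"
proof -
  have "\<forall>t\<in>set [True, False]. \<forall>r\<in>set [16..31].
      row_ok (regular_row t) (regular_row (\<not> t) (r div 2)) r"
    by code_simp
  moreover have "r \<in> set [16..31]" unfolding set_upto using assms by simp
  moreover have "t \<in> set [True, False]" by simp
  ultimately show ?thesis by blast
qed

text \<open>From 60 on, \<open>x\<close>, its neighbours and \<open>x div 2\<close> are all at least
  30, hence outside the table.\<close>

lemma small_row_ok:
  assumes "0 \<le> x" "x < 60"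
  shows "row_ok row (row (x div 2)) x"
proof -
  have "\<forall>x\<in>set [0..59]. row_ok row (row (x div 2)) x" by code_simp
  moreover have "x \<in> set [0..59]" unfolding set_upto using assms by simp
  ultimately show ?thesis by blast
qed

section \<open>Shift invariance and transfer to large piles\<close>

lemma flip_shift: "2 * k dvd m \<Longrightarrow> flip k d (x + m) = flip k d x + m"
proof -
  assume "2 * k dvd m"
  then obtain j where "m = 2 * k * j" ..
  then have "(x + m + d) mod (2 * k) = (x + d) mod (2 * k)"
    using mod_mult_self1[of "x + d" j "2 * k"] by (simp add: algebra_simps)
  then show ?thesis by (simp add: flip_def)
qed

lemma length_regular_row [simp]: "length (regular_row t x) = 7"
  by (simp add: regular_row_def Let_def)

lemma regular_row_shift:
  assumes "8 dvd m"
  shows "regular_row t (x + m) = map (\<lambda>v. v + m) (regular_row t x)"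
proof -
  have "2 dvd m" "4 dvd m" using assms by presburger+
  then show ?thesis using assms by (simp add: regular_row_def Let_def flip_shift)
qed

lemma length_row [simp]: "0 \<le> x \<Longrightarrow> length (row x) = 7"
proof (cases "x < 30")
  case True
  assume "0 \<le> x"
  then have "x \<in> set [0..29]" unfolding set_upto using True by simp
  moreover have "\<forall>x\<in>set [0..29]. length (row x) = 7" by code_simp
  ultimately show ?thesis by blast
qed (simp add: row_def)

lemma row_eq_regular_row: "30 \<le> x \<Longrightarrow> row x = regular_row (phase x) x"
  by (simp add: row_def)

text \<open>The phase switches at 28, 56, 112, ..., all multiples of 4, so it is constant on each
  aligned block of four from 28 on.\<close>

lemma phase_cong:
  "\<lbrakk>28 \<le> x; 28 \<le> y; x div 4 = y div 4\<rbrakk> \<Longrightarrow> phase x = phase y"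
proof (induction x arbitrary: y rule: phase.induct)
  case (1 x)
  show ?case
  proof (cases "x < 56")
    case True
    \<comment> \<open>As 56 is a multiple of 4, \<open>y\<close> lies below it together with
      \<open>x\<close>.\<close>
    then have "x div 2 < 28" "y div 2 < 28" using 1(4) by presburger+
    then show ?thesis
      using 1(2,3) by (simp add: phase.simps[of x] phase.simps[of y] phase.simps[of "x div 2"]
          phase.simps[of "y div 2"])
  next
    case False
    have div: "z div 2 div 4 = z div 4 div 2" for z :: int
      using zdiv_zmult2_eq[of 4 z 2] zdiv_zmult2_eq[of 2 z 4] by simp
    have "14 \<le> x div 4" using False by linarith
    then have "28 \<le> x div 2" "28 \<le> y div 2" using 1(4) by linarith+
    moreover have "x div 2 div 4 = y div 2 div 4" unfolding div 1(4) ..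
    ultimately
    have "phase (x div 2) = phase (y div 2)"
      using 1(2) by (intro 1(1)) simp_all
    then show ?thesis using 1(2,3) by (simp add: phase.simps[of x] phase.simps[of y])
  qed
qed

lemma flip_div_4: "flip 1 0 x div 4 = x div 4" "flip 2 0 x div 4 = x div 4"
  unfolding flip_def by presburger+

lemma regular_row_nth_div_4:
  assumes "c < 4"
  shows "regular_row t x ! c div 4 = x div 4"
proof -
  have "c = 0 \<or> c = 1 \<or> c = 2 \<or> c = 3" using assms by auto
  then show ?thesis by (auto simp: regular_row_def Let_def flip_div_4)
qed

lemma regular_row_nth_indep:
  assumes "4 \<le> c" "c < 7"
  shows "regular_row t x ! c = regular_row u x ! c"
proof -
  have "c = 4 \<or> c = 5 \<or> c = 6" using assms by auto
  then show ?thesis by (auto simp: regular_row_def Let_def)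
qed

text \<open>Lets one phase serve for all neighbours of \<open>x\<close>: entries 0 to 3 are compared
  only inside a block, where the phase is constant, and the others do not depend on it.\<close>

lemma row_nth_eq:
  assumes "30 \<le> x" "30 \<le> y" "c < 7" "c < 4 \<Longrightarrow> y div 4 = x div 4"
  shows "row y ! c = regular_row (phase x) y ! c"
proof (cases "c < 4")
  case True
  then have "phase y = phase x" using assms by (intro phase_cong) auto
  then show ?thesis using assms by (simp add: row_eq_regular_row)
next
  case False
  then show ?thesis using assms regular_row_nth_indep[of c "phase y" y "phase x"]
    by (simp add: row_eq_regular_row)
qed

lemma large_row_ok:
  assumes "60 \<le> x"
  shows "row_ok row (row (x div 2)) x"
proof -
  \<comment> \<open>\<open>r\<close> represents \<open>x\<close> modulo 16 in the verified range;
    since 16 divides \<open>m\<close>, halving commutes with the shift by \<open>m\<close>.\<close>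
  define r where "r = x mod 16 + 16"
  define m where "m = x - r"
  define t where "t = phase x"
  have r: "16 \<le> r" "r \<le> 31" by (simp_all add: r_def)
  have m: "16 dvd m" unfolding m_def r_def by presburger
  obtain k where k: "m = 16 * k" using m ..
  have m8: "8 dvd m" "8 dvd m div 2" using k by simp_all
  have x: "x = r + m" by (simp add: m_def)
  have half: "x div 2 = r div 2 + m div 2" unfolding x k by simp
  have rx: "row x = map (\<lambda>v. v + m) (regular_row t r)"
    using assms regular_row_shift[OF m8(1), of t r] by (simp add: row_eq_regular_row t_def x)
  have "phase (x div 2) = (\<not> t)"
    using assms by (simp add: t_def phase.simps[of x])
  moreover have "30 \<le> x div 2" using assms by simp
  ultimately have rh: "row (x div 2) = map (\<lambda>v. v + m div 2) (regular_row (\<not> t) (r div 2))"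
    using regular_row_shift[OF m8(2), of "\<not> t" "r div 2"]
    by (simp add: row_eq_regular_row half[symmetric])
  have ok: "row_ok (regular_row t) (regular_row (\<not> t) (r div 2)) r"
    using regular_row_ok[OF r] .
  have half_nth: "row (x div 2) ! (c div 2) = regular_row (\<not> t) (r div 2) ! (c div 2) + m div 2"
    if "c < 7" for c
    using that by (simp add: rh)
  have shift_half: "(v + m) div 2 = v div 2 + m div 2" for v
    unfolding k by simp
  have main: "0 \<le> row x ! c \<and> \<bar>row x ! c - x\<bar> \<le> 8 \<and>
     row x ! c div 2 \<noteq> row (x div 2) ! (c div 2)" if c: "c < 7" for c
  proof -
    have *: "\<bar>regular_row t r ! c - r\<bar> \<le> 8"
      "regular_row t r ! c div 2 \<noteq> regular_row (\<not> t) (r div 2) ! (c div 2)"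
      using ok c r unfolding row_ok_iff by auto
    have "row x ! c = regular_row t r ! c + m" using c by (simp add: rx)
    moreover have "0 \<le> row x ! c" "\<bar>row x ! c - x\<bar> \<le> 8"
      using calculation *(1) assms x by linarith+
    ultimately show ?thesis using *(2) half_nth[OF c] shift_half by simp
  qed
  have pair: "(row x ! c = y \<longrightarrow> row y ! c = x) \<and>
        (y < row x ! c \<and> x < row y ! c \<longrightarrow>
          y \<in> set (take c (row x)) \<or> y div 2 = row (x div 2) ! (c div 2))"
    if c: "c < 7" and y: "x - 8 \<le> y" "y \<le> x + 8" for c y
  proof -
    define s where "s = y - m"
    have ys: "y = s + m" by (simp add: s_def)
    have "r - 8 \<le> s" "s \<le> r + 8" "0 \<le> s" using y r by (auto simp: s_def x)
    then have *: "regular_row t r ! c = s \<longrightarrow> regular_row t s ! c = r"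
      "s < regular_row t r ! c \<and> r < regular_row t s ! c \<longrightarrow>
         s \<in> set (take c (regular_row t r)) \<or> s div 2 = regular_row (\<not> t) (r div 2) ! (c div 2)"
      using ok c unfolding row_ok_iff by blast+
    have y30: "30 \<le> y" using y assms by simp
    have xc: "row x ! c = regular_row t r ! c + m" using c by (simp add: rx)
    have mem: "y \<in> set (take c (row x)) \<longleftrightarrow> s \<in> set (take c (regular_row t r))"
      by (auto simp: rx take_map ys)
    show ?thesis
    proof (cases "c < 4 \<longrightarrow> y div 4 = x div 4")
      case True
      then have "row y ! c = regular_row t y ! c"
        using row_nth_eq[of x y c] assms y30 c by (auto simp: t_def)
      also have "\<dots> = regular_row t s ! c + m"
        using regular_row_shift[OF m8(1), of t s] c by (simp add: ys)
      finally show ?thesis using * xc mem half_nth[OF c] shift_half[of s] x ys by auto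
    next
      \<comment> \<open>Here \<open>c < 4\<close> and the blocks differ, so the phases may differ
        too; but these entries never leave their block.\<close>
      case False
      then have "row x ! c div 4 = x div 4" "row y ! c div 4 = y div 4"
        using assms y30 by (auto simp: row_eq_regular_row regular_row_nth_div_4)
      \<comment> \<open>Both inequalities together would force equal block indices.\<close>
      moreover have "\<not> (y < row x ! c \<and> x < row y ! c)"
      proof
        assume "y < row x ! c \<and> x < row y ! c"
        then have "y div 4 \<le> row x ! c div 4" "x div 4 \<le> row y ! c div 4"
          by (auto intro: zdiv_mono1)
        then show False using calculation False by simp
      qed
      ultimately show ?thesis using False by auto
    qed
  qed
  have "distinct (row x)"
    using ok by (simp add: row_ok_iff rx distinct_map inj_on_def)
  then show ?thesis using main pair unfolding row_ok_iff by blast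
qed

section \<open>From the condition to the P-positions\<close>

lemma row_ok: "0 \<le> x \<Longrightarrow> row_ok row (row (x div 2)) x"
  using small_row_ok large_row_ok by (cases "x < 60") auto

lemma row_nth_nonneg: "\<lbrakk>0 \<le> x; c < 7\<rbrakk> \<Longrightarrow> 0 \<le> row x ! c"
  using row_ok[of x] unfolding row_ok_iff by blast

lemma row_nth_near: "\<lbrakk>0 \<le> x; c < 7\<rbrakk> \<Longrightarrow> \<bar>row x ! c - x\<bar> \<le> 8"
  using row_ok[of x] unfolding row_ok_iff by blast

lemma row_nth_involution:
  assumes "0 \<le> x" "c < 7"
  shows "row (row x ! c) ! c = x"
proof -
  have "x - 8 \<le> row x ! c" "row x ! c \<le> x + 8"
    using row_nth_near[OF assms] by linarith+
  then show ?thesis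
    using row_ok[OF assms(1)] row_nth_nonneg[OF assms] assms(2) unfolding row_ok_iff by blast
qed

lemma row_nth_inject: "\<lbrakk>0 \<le> x; c < 7; c' < 7; row x ! c = row x ! c'\<rbrakk> \<Longrightarrow> c = c'"
  using row_ok[of x] by (simp add: row_ok_iff nth_eq_iff_index_eq)

lemma row_nth_halving:
  "\<lbrakk>0 \<le> x; c < 7; x \<noteq> 0 \<or> c \<noteq> 0\<rbrakk> \<Longrightarrow> row x ! c div 2 \<noteq> row (x div 2) ! (c div 2)"
  using row_ok[of x] unfolding row_ok_iff by blast

lemma row_0_0: "row 0 ! 0 = 0"
  by (simp add: row_def)

text \<open>Entries differ from their index by at most 8, so the two inequalities put
  \<open>y\<close> into the window that \<open>row_ok\<close> examines.\<close>

lemma row_complete: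
  assumes "0 \<le> x" "0 \<le> y" "c < 7" "y < row x ! c" "x < row y ! c"
  shows "y \<in> set (take c (row x)) \<or> y div 2 = row (x div 2) ! (c div 2)"
proof -
  have "x - 8 \<le> y" "y \<le> x + 8"
    using row_nth_near[of x c] row_nth_near[of y c] assms by linarith+
  then show ?thesis using row_ok[of x] assms unfolding row_ok_iff by blast
qed

lemma P_position_iff_row:
  assumes "c \<le> 6"
  shows "P_position {#a, b, c#} \<longleftrightarrow> int b = row (int a) ! c"
proof -
  define R where "R = (\<lambda>c a b. int b = row (int a) ! c)"
  have zero: "R 0 0 b \<longleftrightarrow> b = 0" for b by (simp add: R_def row_0_0)
  have sym: "R c b a" if "c \<le> 6" "R c a b" for c a b
    using that row_nth_involution[of "int a" c] by (simp add: R_def)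
  have halving: "\<not> R (c div 2) (a div 2) (b div 2)"
    if "c \<le> 6" "R c a b" "(a, b, c) \<noteq> (0, 0, 0)" for c a b
  proof -
    have "int a \<noteq> 0 \<or> c \<noteq> 0"
    proof (rule ccontr)
      assume "\<not> (int a \<noteq> 0 \<or> c \<noteq> 0)"
      then have "a = 0" "c = 0" by simp_all
      then show False using that(2,3) zero[of b] by simp
    qed
    then show ?thesis
      using row_nth_halving[of "int a" c] that by (simp add: R_def zdiv_int)
  qed
  have complete: "(\<exists>b'<b. R c a b') \<or> (\<exists>a'<a. R c a' b) \<or> (\<exists>c'<c. R c' a b) \<or>
      R (c div 2) (a div 2) (b div 2)" if "c \<le> 6" "\<not> R c a b" for c a b
  proof -
    define v where "v = row (int a) ! c"
    define u where "u = row (int b) ! c"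
    have nonneg: "0 \<le> v" "0 \<le> u" using that by (simp_all add: v_def u_def row_nth_nonneg)
    have Rv: "R c a (nat v)" using nonneg by (simp add: R_def v_def)
    have Ru: "R c (nat u) b" using sym[of c b "nat u"] that nonneg by (simp add: R_def u_def)
    have "v \<noteq> int b" using that by (simp add: R_def v_def)
    have "u \<noteq> int a" using Ru that nonneg by auto
    \<comment> \<open>Either lowering \<open>b\<close> to \<open>v\<close> or \<open>a\<close> to
      \<open>u\<close> reaches a pair of the involution, or both piles are too small for that and
      \<open>row_complete\<close> applies.\<close>
    consider "v < int b" | "u < int a" | "int b < v" "int a < u"
      using \<open>v \<noteq> int b\<close> \<open>u \<noteq> int a\<close> by linarith
    then show ?thesis
    proof cases
      case 1
      then have "nat v < b" using nonneg by simp
      then show ?thesis using Rv by blast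
    next
      case 2
      then have "nat u < a" using nonneg by simp
      then show ?thesis using Ru by blast
    next
      case 3
      then have "int b \<in> set (take c (row (int a))) \<or> int b div 2 = row (int a div 2) ! (c div 2)"
        using row_complete[of "int a" "int b" c] that by (simp add: u_def v_def)
      moreover have "\<exists>c'<c. R c' a b" if "int b \<in> set (take c (row (int a)))"
        using that by (auto simp: R_def in_set_conv_nth)
      ultimately show ?thesis by (auto simp: R_def zdiv_int)
    qed
  qed
  have "P_position {#a, b, c#} \<longleftrightarrow> R c a b"
  proof (rule P_position_three_piles_characterization[of 6 R])
    show "c = c'" if "c \<le> 6" "c' \<le> 6" "R c a b" "R c' a b" for c c' a b
      using that row_nth_inject[of "int a" c c'] by (simp add: R_def)
    show "R 0 0 0" by (simp add: zero)
  qed (use sym halving complete assms in \<open>auto simp: R_def\<close>)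
  then show ?thesis by (simp add: R_def)
qed

section \<open>The closed form for a third pile of 6\<close>

text \<open>XOR with 4 toggles bit 2, which is clear exactly when \<open>n mod 8 < 4\<close>. The
  other case follows because toggling twice is the identity.\<close>

lemma xor_4_eq: "(n :: nat) XOR 4 = (if n mod 8 < 4 then n + 4 else n - 4)"
proof -
  have *: "m XOR 4 = m + 4" if "m mod 8 < 4" for m :: nat
  proof -
    have "m div 4 mod 2 = 0" using that by presburger
    then have "\<not> bit m 2" by (simp add: bit_iff_odd even_iff_mod_2_eq_zero)
    then have "set_bit 2 m = m + 4" by (simp add: set_bit_eq)
    moreover have "m XOR 4 = flip_bit 2 m" by (simp add: flip_bit_eq_xor push_bit_eq_mult)
    ultimately show ?thesis using \<open>\<not> bit m 2\<close> by (simp add: flip_bit_eq_if)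
  qed
  show ?thesis
  proof (cases "n mod 8 < 4")
    case False
    then have "4 \<le> n" using mod_less_eq_dividend[of n 8] by linarith
    then obtain m where m: "n = m + 4" by (metis add.commute le_Suc_ex)
    have "m mod 8 < 4" using False unfolding m by presburger
    then have "n XOR 4 = m" using *[of m] by (simp add: m xor.assoc flip: *)
    then show ?thesis using False by (simp add: m)
  qed (simp add: *)
qed

lemma int_phi6: "int (phi6 x) = row (int x) ! 6"
proof (cases "x < 30")
  case True
  then have "x \<in> set [0..<30]" by simp
  moreover have "\<forall>x\<in>set [0..<30]. int (phi6 x) = row (int x) ! 6" by code_simp
  ultimately show ?thesis by blast
next
  case False
  \<comment> \<open>Matches the case condition of \<open>flip\<close> on integers with that of
    \<open>xor_4_eq\<close> on naturals.\<close>
  have "(int x + 2) mod 8 < 4 \<longleftrightarrow> Suc (Suc x) mod 8 < 4" by presburger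
  then show ?thesis using False
    by (auto simp: phi6_def shifted_xor_def xor_4_eq row_eq_regular_row regular_row_def Let_def
        flip_def)
qed

theorem theorem31:
  shows "(\<forall>a b. P_position {#a, b, 6#} \<longleftrightarrow> b = phi6 a) \<and>
    (\<forall>a b. a \<ge> 30 \<and> b \<ge> 30 \<longrightarrow>
      (P_position {#a, b, 6#} \<longleftrightarrow> (a + 2) XOR (b + 2) = 4))"
proof -
  have P: "P_position {#a, b, 6#} \<longleftrightarrow> b = phi6 a" for a b
    by (simp add: P_position_iff_row flip: int_phi6)
  moreover have "b = phi6 a \<longleftrightarrow> (a + 2) XOR (b + 2) = 4" if "30 \<le> a" for a b
  proof -
    \<comment> \<open>Ensures that the truncated subtraction in \<open>shifted_xor\<close> is exact
      and can be undone by adding 2.\<close>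
    have "2 \<le> (a + 2) XOR 4" using that by (auto simp: xor_4_eq)
    then have "b = phi6 a \<longleftrightarrow> b + 2 = (a + 2) XOR 4"
      using that by (auto simp: phi6_def shifted_xor_def)
    also have "\<dots> \<longleftrightarrow> (a + 2) XOR (b + 2) = 4"
      by (metis xor.assoc xor_self_eq xor.left_neutral)
    finally show ?thesis .
  qed
  ultimately show ?thesis by auto
qed

end
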